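(* Let $S(z)=\sum_{k\ge0}s_kz^k$ be the power series whose coefficients are defined by $s_0=1$ and, for all $k\ge0$, $s_{4k}=s_{4k+1}=s_k$, $s_{4k+2}=0$, and $s_{4k+3}=0$ if $k\equiv 3\pmod 4$, $s_{4k+3}=s_{k+1}$ otherwise (so $S(z)=1+z+z^3+z^4+z^5+z^{11}+z^{12}+z^{13}+z^{16}+z^{17}+z^{19}+\cdots$, and $S(z^{16})=-zS(z)+(1+z+z^2)S(z^4)$). Then for every integer $b\ge2$, \[\mu\left(S\left(\tfrac1b\right),S\left(\tfrac1{b^4}\right)\right)\le\tfrac{516}{253}.\] Moreover, if $a/b\in\mathbb{Q}$ with $a,b$ integers, $b\ge2$, $\log|a|=\lambda\log b$ and $0\le\lambda<178/291$, then \[\mu\left(S\left(\tfrac ab\right),S\left(\tfrac{a^4}{b^4}\right)\right)\le\frac{516(1-\lambda)}{253-381\lambda}.\]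
   Context: For real numbers $\alpha_1,\dots,\alpha_n$, the simultaneous approximation exponent $\mu(\alpha_1,\dots,\alpha_n)$ is the supremum of the real numbers $\mu$ such that the inequality $\max_{1\le i\le n}|\alpha_i-p_i/q|<q^{-\mu}$ has infinitely many solutions in rational numbers $p_i/q$ (with common denominator $q\ge1$). The coefficients $s_k$ lie in $\{0,1\}$, so $S$ converges for $|z|<1$. *)

theory Defs
  imports "HOL-Analysis.Analysis"
begin

function s :: "nat \<Rightarrow> nat" where
  "s n = (if n = 0 then 1
          else if n mod 4 = 0 \<or> n mod 4 = 1 then s (n div 4)
          else if n mod 4 = 2 then 0
          else if (n div 4) mod 4 = 3 then 0
          else s (n div 4 + 1))"
  by auto
termination
  by (relation "Wellfounded.measure id") auto

declare s.simps [simp del]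

definition S :: "real \<Rightarrow> real" where
  "S z = (\<Sum>k. real (s k) * z ^ k)"

definition mu2 :: "real \<Rightarrow> real \<Rightarrow> ereal" where
  "mu2 \<alpha>1 \<alpha>2 = Sup {ereal m | m. infinite {(p1::int, p2::int, q::int).
       q \<ge> 1 \<and> max \<bar>\<alpha>1 - of_int p1 / of_int q\<bar> \<bar>\<alpha>2 - of_int p2 / of_int q\<bar>
         < real_of_int q powr (- m)}}"

end

theory Submission
  imports Defs
begin

text \<open>
  Let \<open>F(w) = A0(w) + A1(w) S(w) + A2(w) S(w^4)\<close> have integer polynomial coefficients and vanish
  to order exactly \<open>o\<close> at \<open>0\<close>. Put \<open>w = z^(4^k)\<close> with \<open>\<bar>z\<bar> = b^(-x)\<close>, where \<open>x = 1 - \<lambda>\<close>. Iterating the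
  functional equation turns \<open>F(w)\<close> into a linear form in \<open>1, S(z), S(z^4)\<close> whose coefficients are
  bounded, become integers after multiplication by \<open>b^(h 4^k)\<close> for
  \<open>h = max (deg A0) (deg A1 + 1/6) (deg A2 + 2/3)\<close>, and whose value has the exact size
  \<open>b^(-x o 4^k)\<close>. Whether or not this form vanishes at \<open>(q, p1, p2)\<close>, it follows that the distance of
  \<open>(p1/q, p2/q)\<close> from \<open>(S(z), S(z^4))\<close> is at least of order \<open>b^(-x o 4^k)\<close> as long as \<open>q\<close> is at
  most of order \<open>b^((x o - h) 4^k)\<close>. No linear independence of several forms is needed.

  Four forms, with \<open>(o, h) = (127, 253/6), (43, 11), (4, 2/3), (6, 2)\<close>, taken at the levels
  \<open>k, k + 1, k + 3, k + 3\<close>, have the orders \<open>127, 172, 256, 384\<close> relative to \<open>4^k\<close>, and \<open>508 = 4 * 127\<close>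
  starts the next round. For consecutive forms the quotient \<open>x o' / (x o - h)\<close> is at most
  \<open>516 x / (381 x - 128)\<close>, which is the claimed exponent.
\<close>

subsection \<open>The power series and its functional equation\<close>

lemma s_le_1: "s n \<le> 1"
proof (induction n rule: s.induct)
  case (1 n)
  then show ?case by (subst s.simps) auto
qed

lemma s_4k: "s (4 * k) = s k"
  by (subst s.simps) (auto simp: s.simps[of 0])

lemma s_4k1: "s (4 * k + 1) = s k"
proof -
  have "(4 * k + 1) mod 4 = 1" "(4 * k + 1) div 4 = k"
    by presburger+
  then show ?thesis
    by (subst s.simps) simp
qed

lemma s_4k2: "s (4 * k + 2) = 0"
proof -
  have "(4 * k + 2) mod 4 = 2"
    by presburger
  then show ?thesis
    by (subst s.simps) simp
qed

lemma s_4k3: "s (4 * k + 3) = (if 4 dvd Suc k then 0 else s (Suc k))"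
proof -
  have "(4 * k + 3) mod 4 = 3" "(4 * k + 3) div 4 = k" "k mod 4 = 3 \<longleftrightarrow> 4 dvd Suc k"
    by presburger+
  then show ?thesis
    by (subst s.simps) simp
qed

section \<open>Convergence of the series and regrouping into blocks of four\<close>

lemma s_term_le: "norm (real (s k) * z ^ k) \<le> \<bar>z\<bar> ^ k"
  using s_le_1[of k] by (simp add: abs_mult power_abs mult_left_le_one_le)

lemma summable_S: "\<bar>z\<bar> < 1 \<Longrightarrow> summable (\<lambda>k. real (s k) * z ^ k)"
  by (rule summable_comparison_test'[where g = "\<lambda>k. \<bar>z\<bar> ^ k" and N = 0])
    (use s_term_le in \<open>auto intro: summable_geometric\<close>)

lemma S_sums: "\<bar>z\<bar> < 1 \<Longrightarrow> (\<lambda>k. real (s k) * z ^ k) sums S z"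
  unfolding S_def by (rule summable_sums[OF summable_S])

lemma S_sums_power:
  assumes "\<bar>z\<bar> < 1" "n > 0"
  shows "(\<lambda>k. real (s k) * z ^ (n * k)) sums S (z ^ n)"
  using S_sums[of "z ^ n"] assms by (simp add: power_mult power_abs power_less_one_iff)

lemma sums_blocks_of_4:
  fixes f :: "nat \<Rightarrow> real"
  assumes "f sums l"
  shows "(\<lambda>n. f (4 * n) + f (4 * n + 1) + f (4 * n + 2) + f (4 * n + 3)) sums l"
proof -
  have "sum f {n * 4..<n * 4 + 4} = f (4 * n) + f (4 * n + 1) + f (4 * n + 2) + f (4 * n + 3)" for n
    by (simp add: eval_nat_numeral atLeastLessThanSuc algebra_simps)
  with sums_group[OF assms, of 4] show ?thesis
    by simp
qed

text \<open>Split \<open>z * S z\<close> by the index modulo 4. Classes 0 and 1 give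
  \<open>(z + z^2) * S (z^4)\<close> and class 2 nothing. Class 3 gives the terms of
  \<open>S (z^4)\<close> at indices n + 1, except multiples of 4; by \<open>s_4k\<close> those
  excepted belong to \<open>S (z^16)\<close>.\<close>

lemma S_functional_equation:
  assumes z: "\<bar>z\<bar> < 1"
  shows "S (z ^ 16) = - z * S z + (1 + z + z\<^sup>2) * S (z ^ 4)"
proof -
  define h where "h m = (if 4 dvd m then real (s m) * z ^ (4 * m) else 0)" for m
  define g where "g m = real (s m) * z ^ (4 * m) - h m" for m
  have S4: "(\<lambda>m. real (s m) * z ^ (4 * m)) sums S (z ^ 4)"
    using S_sums_power[OF z, of 4] by simp
  have "\<bar>z ^ 4\<bar> < 1"
    unfolding power_abs by (subst power_less_one_iff) (use z in auto)
  then have geo: "summable (\<lambda>m. \<bar>z ^ 4\<bar> ^ m)"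
    by (intro summable_geometric) simp
  have "norm (h m) \<le> \<bar>z ^ 4\<bar> ^ m" for m
    using s_term_le[of m "z ^ 4"] unfolding h_def power_mult by simp
  then have "summable h"
    by (rule summable_comparison_test'[where N = 0, OF geo])
  then have h: "h sums suminf h"
    by (rule summable_sums)
  have "h (4 * n) + h (4 * n + 1) + h (4 * n + 2) + h (4 * n + 3) = real (s n) * z ^ (16 * n)" for n
  proof -
    have "\<not> 4 dvd 4 * n + 1" "\<not> 4 dvd 4 * n + 2" "\<not> 4 dvd 4 * n + 3"
      by presburger+
    then show ?thesis
      unfolding h_def by (simp add: s_4k)
  qed
  with sums_blocks_of_4[OF h] have "(\<lambda>n. real (s n) * z ^ (16 * n)) sums suminf h"
    by simp
  with S_sums_power[OF z, of 16] have "suminf h = S (z ^ 16)"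
    using sums_unique2 by auto
  with h S4 have "g sums (S (z ^ 4) - S (z ^ 16))"
    unfolding g_def by (intro sums_diff) auto
  \<comment> \<open>The constant terms of \<open>S (z^4)\<close> and \<open>S (z^16)\<close> cancel,
    so the sum can start at index 1, as class 3 requires.\<close>
  moreover have "g 0 = 0"
    by (simp add: g_def h_def)
  ultimately have g: "(\<lambda>n. g (Suc n)) sums (S (z ^ 4) - S (z ^ 16))"
    by (simp add: sums_Suc_iff)
  have g': "g (Suc n) = z * (real (s (4 * n + 3)) * z ^ (4 * n + 3))" for n
  proof -
    have "z ^ (4 * Suc n) = z * z ^ (4 * n + 3)"
      by (simp flip: power_Suc)
    then show ?thesis
      unfolding g_def h_def s_4k3 by simp
  qed
  have "(\<lambda>n. z * (real (s (4 * n)) * z ^ (4 * n) + real (s (4 * n + 1)) * z ^ (4 * n + 1)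
      + real (s (4 * n + 2)) * z ^ (4 * n + 2) + real (s (4 * n + 3)) * z ^ (4 * n + 3)))
      sums (z * S z)"
    by (intro sums_mult sums_blocks_of_4[where f = "\<lambda>k. real (s k) * z ^ k"] S_sums z)
  moreover have "z * (real (s (4 * n)) * z ^ (4 * n) + real (s (4 * n + 1)) * z ^ (4 * n + 1)
      + real (s (4 * n + 2)) * z ^ (4 * n + 2) + real (s (4 * n + 3)) * z ^ (4 * n + 3))
      = (z + z\<^sup>2) * (real (s n) * z ^ (4 * n)) + g (Suc n)" for n
    unfolding s_4k s_4k1 s_4k2 g' by (simp add: algebra_simps power2_eq_square)
  moreover have "(\<lambda>n. (z + z\<^sup>2) * (real (s n) * z ^ (4 * n)) + g (Suc n))
      sums ((z + z\<^sup>2) * S (z ^ 4) + (S (z ^ 4) - S (z ^ 16)))"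
    by (intro sums_add sums_mult S4 g)
  ultimately have "z * S z = (z + z\<^sup>2) * S (z ^ 4) + (S (z ^ 4) - S (z ^ 16))"
    using sums_unique2 by fastforce
  then show ?thesis
    by (simp add: algebra_simps)
qed

lemma S_tail:
  assumes w: "\<bar>w\<bar> \<le> 1/2"
  shows "\<bar>S w - (\<Sum>i<n. real (s i) * w ^ i)\<bar> \<le> 2 * \<bar>w\<bar> ^ n"
proof -
  have sm: "summable (\<lambda>k. real (s k) * w ^ k)"
    using w by (intro summable_S) auto
  have geo: "summable (\<lambda>k. \<bar>w\<bar> ^ n * \<bar>w\<bar> ^ k)"
    using w by (intro summable_mult summable_geometric) auto
  have "\<bar>S w - (\<Sum>i<n. real (s i) * w ^ i)\<bar> = norm (\<Sum>k. real (s (k + n)) * w ^ (k + n))"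
    unfolding S_def by (subst suminf_split_initial_segment[OF sm, of n]) simp
  also have "\<dots> \<le> (\<Sum>k. \<bar>w\<bar> ^ n * \<bar>w\<bar> ^ k)"
    by (rule norm_suminf_le[OF _ geo]) (metis s_term_le add.commute power_add)
  also have "\<dots> = \<bar>w\<bar> ^ n * (1 / (1 - \<bar>w\<bar>))"
    using w by (subst suminf_mult) (auto simp: suminf_geometric intro: summable_geometric)
  also have "\<dots> \<le> \<bar>w\<bar> ^ n * 2"
    using w by (intro mult_left_mono) (auto simp: field_simps)
  finally show ?thesis
    by simp
qed

subsection \<open>Iterating the functional equation\<close>

text \<open>The functional equation at z^(4^k). Free starting values let one argument serve both
  coefficient sequences: (1, 0) yields the coefficient of \<open>S z\<close>, (0, 1) that of
  \<open>S (z^4)\<close>.\<close>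

fun iter_coeff :: "real \<Rightarrow> real \<Rightarrow> real \<Rightarrow> nat \<Rightarrow> real" where
  "iter_coeff z u v 0 = u"
| "iter_coeff z u v (Suc 0) = v"
| "iter_coeff z u v (Suc (Suc k)) = - (z ^ 4 ^ k) * iter_coeff z u v k
     + (1 + z ^ 4 ^ k + (z ^ 4 ^ k)\<^sup>2) * iter_coeff z u v (Suc k)"

lemma S_iterate:
  assumes z: "\<bar>z\<bar> < 1"
  shows "S (z ^ 4 ^ k) = iter_coeff z 1 0 k * S z + iter_coeff z 0 1 k * S (z ^ 4)"
proof (induction k rule: induct_nat_012)
  case (ge2 k)
  have "\<bar>z ^ 4 ^ k\<bar> < 1"
    using z by (simp add: power_abs power_less_one_iff)
  have "S (z ^ 4 ^ Suc (Suc k)) = S ((z ^ 4 ^ k) ^ 16)"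
    by (simp add: mult.commute flip: power_mult)
  also have "\<dots> = - (z ^ 4 ^ k) * S (z ^ 4 ^ k)
      + (1 + z ^ 4 ^ k + (z ^ 4 ^ k)\<^sup>2) * S ((z ^ 4 ^ k) ^ 4)"
    by (rule S_functional_equation) fact
  also have "(z ^ 4 ^ k) ^ 4 = z ^ 4 ^ Suc k"
    by (simp add: mult.commute flip: power_mult)
  finally show ?case
    unfolding ge2.IH by (simp add: algebra_simps)
qed auto


text \<open>With t = |z|^(4^k), the two factors in the recursion have absolute values summing to at
  most 1 + 3 t, hence to at most exp(3 t). A common bound for two consecutive values therefore grows
  by this factor only.\<close>

lemma iter_coeff_le_exp:
  assumes z: "\<bar>z\<bar> < 1" and uv: "\<bar>u\<bar> \<le> 1" "\<bar>v\<bar> \<le> 1"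
  defines "E \<equiv> \<lambda>k. exp (3 * (\<Sum>j<k. \<bar>z\<bar> ^ 4 ^ j))"
  shows "\<bar>iter_coeff z u v k\<bar> \<le> E k \<and> \<bar>iter_coeff z u v (Suc k)\<bar> \<le> E k"
proof (induction k)
  case 0
  then show ?case
    using uv by (simp add: E_def)
next
  case (Suc k)
  define t where "t = \<bar>z\<bar> ^ 4 ^ k"
  have t: "0 \<le> t" "t \<le> 1"
    using z by (auto simp: t_def power_le_one)
  have E: "E (Suc k) = exp (3 * t) * E k"
    by (simp add: E_def t_def exp_add algebra_simps)
  have "1 + 3 * t \<le> exp (3 * t)"
    by (rule exp_ge_add_one_self)
  then have *: "(1 + 3 * t) * E k \<le> E (Suc k)"
    unfolding E by (rule mult_right_mono) (simp add: E_def)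
  let ?w = "z ^ 4 ^ k"
  have w: "\<bar>?w\<bar> = t"
    by (simp add: t_def power_abs)
  have "\<bar>1 + ?w + ?w\<^sup>2\<bar> \<le> 1 + \<bar>?w\<bar> + \<bar>?w\<bar> * \<bar>?w\<bar>"
    unfolding power2_eq_square abs_mult_self_eq using zero_le_square[of ?w] by arith
  moreover have "\<bar>?w\<bar> * \<bar>?w\<bar> \<le> t"
    using t unfolding w by (simp add: mult_left_le_one_le)
  ultimately have q: "\<bar>1 + ?w + ?w\<^sup>2\<bar> \<le> 1 + 2 * t"
    unfolding w by linarith
  have "\<bar>iter_coeff z u v (Suc (Suc k))\<bar> \<le> \<bar>?w\<bar> * \<bar>iter_coeff z u v k\<bar>
      + \<bar>1 + ?w + ?w\<^sup>2\<bar> * \<bar>iter_coeff z u v (Suc k)\<bar>"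
    unfolding iter_coeff.simps by (rule order_trans[OF abs_triangle_ineq]) (simp add: abs_mult)
  also have "\<dots> \<le> t * E k + (1 + 2 * t) * E k"
    using Suc t q unfolding w by (intro add_mono mult_mono) auto
  also have "\<dots> = (1 + 3 * t) * E k"
    by (simp add: algebra_simps)
  finally have "\<bar>iter_coeff z u v (Suc (Suc k))\<bar> \<le> E (Suc k)"
    using * by simp
  moreover have "E k \<le> E (Suc k)"
    using t by (simp add: E_def t_def)
  ultimately show ?case
    using Suc by auto
qed

lemma iter_coeff_bounded:
  assumes z: "\<bar>z\<bar> < 1" and uv: "\<bar>u\<bar> \<le> 1" "\<bar>v\<bar> \<le> 1"
  shows "\<bar>iter_coeff z u v k\<bar> \<le> exp (3 / (1 - \<bar>z\<bar>))"
proof -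
  have "j \<le> 4 ^ j" for j :: nat
    by (rule less_imp_le, rule less_exp[THEN order_less_le_trans]) (simp add: power_mono)
  then have "(\<Sum>j<k. \<bar>z\<bar> ^ 4 ^ j) \<le> (\<Sum>j<k. \<bar>z\<bar> ^ j)"
    using z by (intro sum_mono power_decreasing) auto
  also have "\<dots> \<le> (\<Sum>j. \<bar>z\<bar> ^ j)"
    using z by (intro sum_le_suminf summable_geometric) auto
  also have "\<dots> = 1 / (1 - \<bar>z\<bar>)"
    using z by (intro suminf_geometric) simp
  finally have "exp (3 * (\<Sum>j<k. \<bar>z\<bar> ^ 4 ^ j)) \<le> exp (3 / (1 - \<bar>z\<bar>))"
    by simp
  with iter_coeff_le_exp[OF assms, of k] show ?thesis
    by linarith
qed

text \<open>Exponent of b clearing the denominator of \<open>iter_coeff\<close> at a/b. For k >= 1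
  it equals (4^k - 4)/6; levels k and k + 1 thus cost at most 1/6 and 2/3 of 4^k.\<close>

fun iter_deg :: "nat \<Rightarrow> nat" where
  "iter_deg 0 = 0"
| "iter_deg (Suc 0) = 0"
| "iter_deg (Suc (Suc k)) = iter_deg (Suc k) + 2 * 4 ^ k"

lemma iter_deg_le: "6 * iter_deg k \<le> 4 ^ k"
  by (induction k rule: iter_deg.induct) auto

section \<open>Clearing denominators by powers of b\<close>

lemma Ints_power_mult_mono:
  fixes b :: int and t :: real
  assumes "of_int b ^ n * t \<in> \<int>" "n \<le> m"
  shows "of_int b ^ m * t \<in> \<int>"
proof -
  have "of_int b ^ m * t = of_int b ^ (m - n) * (of_int b ^ n * t)"
    by (metis assms(2) le_add_diff_inverse2 mult.assoc power_add)
  with assms(1) show ?thesis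
    by (metis Ints_mult Ints_of_int Ints_power)
qed

lemma Ints_power_mult_mult:
  fixes b :: int and t :: real
  assumes "of_int b ^ n * t \<in> \<int>" "of_int b ^ m * t' \<in> \<int>"
  shows "of_int b ^ (n + m) * (t * t') \<in> \<int>"
  using Ints_mult[OF assms] by (simp add: power_add mult_ac)

lemma Ints_power_mult_power:
  fixes a b :: int
  assumes "b \<noteq> 0"
  shows "of_int b ^ n * (of_int a / of_int b :: real) ^ n \<in> \<int>"
  using assms by (simp add: power_divide)

lemma iter_coeff_Ints:
  fixes a b :: int
  assumes b: "b \<noteq> 0" and uv: "u \<in> \<int>" "v \<in> \<int>"
  defines "z \<equiv> of_int a / of_int b"
  shows "of_int b ^ iter_deg k * iter_coeff z u v k \<in> \<int>"
proof (induction k rule: induct_nat_012)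
  case (ge2 k)
  let ?B = "of_int b :: real" and ?w = "z ^ 4 ^ k"
  have w: "?B ^ 4 ^ k * ?w \<in> \<int>"
    unfolding z_def by (rule Ints_power_mult_power) fact
  \<comment> \<open>The product of \<open>?w\<close> with the older coefficient needs the exponent
    \<open>4 ^ k + iter_deg k\<close>, which stays below \<open>2 * 4 ^ k\<close>.\<close>
  have "6 * iter_deg k \<le> 4 ^ k"
    by (rule iter_deg_le)
  then have 1: "?B ^ iter_deg (Suc (Suc k)) * (?w * iter_coeff z u v k) \<in> \<int>"
    by (intro Ints_power_mult_mono[OF Ints_power_mult_mult[OF w ge2.IH(1)]]) simp
  have "?B ^ (2 * 4 ^ k) * ?w\<^sup>2 \<in> \<int>"
    using Ints_power_mult_mult[OF w w] by (simp add: power2_eq_square mult_2)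
  moreover have "?B ^ (2 * 4 ^ k) * ?w \<in> \<int>"
    by (rule Ints_power_mult_mono[OF w]) simp
  ultimately have *: "?B ^ (2 * 4 ^ k) * (1 + ?w + ?w\<^sup>2) \<in> \<int>"
    by (simp add: distrib_left)
  have 2: "?B ^ iter_deg (Suc (Suc k)) * ((1 + ?w + ?w\<^sup>2) * iter_coeff z u v (Suc k)) \<in> \<int>"
    using Ints_power_mult_mult[OF * ge2.IH(2)] by (simp only: iter_deg.simps add.commute)
  have eq: "?B ^ iter_deg (Suc (Suc k)) * iter_coeff z u v (Suc (Suc k)) =
      ?B ^ iter_deg (Suc (Suc k)) * ((1 + ?w + ?w\<^sup>2) * iter_coeff z u v (Suc k))
      - ?B ^ iter_deg (Suc (Suc k)) * (?w * iter_coeff z u v k)"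
    unfolding iter_coeff.simps by (simp add: algebra_simps)
  show ?case
    unfolding eq using 2 1 by (rule Ints_diff)
qed (use uv in auto)

subsection \<open>Polynomials as coefficient lists and exact vanishing orders\<close>

text \<open>Integer coefficient lists, lowest degree first, make the vanishing orders checkable by
  evaluation.\<close>

fun padd :: "int list \<Rightarrow> int list \<Rightarrow> int list" where
  "padd [] ys = ys"
| "padd xs [] = xs"
| "padd (x # xs) (y # ys) = (x + y) # padd xs ys"

fun pmul :: "int list \<Rightarrow> int list \<Rightarrow> int list" where
  "pmul [] ys = []"
| "pmul (x # xs) ys = padd (map ((*) x) ys) (0 # pmul xs ys)"

abbreviation ev :: "int list \<Rightarrow> real \<Rightarrow> real" where
  "ev p w \<equiv> horner_sum of_int w p"

lemma ev_padd: "ev (padd p q) w = ev p w + ev q w"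
  by (induction p q rule: padd.induct) (auto simp: algebra_simps)

lemma ev_map_mult: "ev (map ((*) c) p) w = of_int c * ev p w"
  by (induction p) (auto simp: algebra_simps)

lemma ev_pmul: "ev (pmul p q) w = ev p w * ev q w"
  by (induction p) (auto simp: ev_padd ev_map_mult algebra_simps)

definition s_list :: "int list" where
  "s_list = map (\<lambda>k. int (s k)) [0..<128]"

fun spread4 :: "int list \<Rightarrow> int list" where
  "spread4 [] = []"
| "spread4 (x # xs) = x # 0 # 0 # 0 # spread4 xs"

lemma ev_spread4: "ev (spread4 p) w = ev p (w ^ 4)"
  by (induction p) (auto simp: eval_nat_numeral algebra_simps)

text \<open>With \<open>S\<close> truncated at order 128, only the coefficients below 128 are those of the actual form.\<close>

definition form_list :: "int list \<Rightarrow> int list \<Rightarrow> int list \<Rightarrow> int list" where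
  "form_list p0 p1 p2 = padd p0 (padd (pmul p1 s_list) (pmul p2 (spread4 (take 32 s_list))))"

lemma s_1: "s (Suc 0) = 1" and s_2: "s (Suc (Suc 0)) = 0"
  by (simp_all add: s.simps[of 0] s.simps[of "Suc _"])

lemma s_list_eq: "s_list = [1, 1, 0, 1, 1, 1, 0, 0, 0, 0, 0, 1, 1, 1, 0, 0, 1, 1, 0, 1, 1, 1, 0, 0,
    0, 0, 0, 0, 0, 0, 0, 0, 0, 0, 0, 0, 0, 0, 0, 0, 0, 0, 0, 1, 1, 1, 0, 0, 1, 1, 0, 1, 1, 1, 0, 0,
    0, 0, 0, 0, 0, 0, 0, 0, 1, 1, 0, 1, 1, 1, 0, 0, 0, 0, 0, 1, 1, 1, 0, 0, 1, 1, 0, 1, 1, 1, 0, 0,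
    0, 0, 0, 0, 0, 0, 0, 0, 0, 0, 0, 0, 0, 0, 0, 0, 0, 0, 0, 0, 0, 0, 0, 0, 0, 0, 0, 0, 0, 0, 0, 0,
    0, 0, 0, 0, 0, 0, 0, 0]"
proof -
  \<comment> \<open>Beyond 0 and 1 all indices are numerals, to which the recursion can be
    restricted as a rewrite rule.\<close>
  have "[0..<128] = 0 # 1 # [2..<128]"
    by (simp add: upt_conv_Cons numeral_2_eq_2)
  then show ?thesis
    unfolding s_list_def list.map
    by (simp add: s.simps[of 0] s_1 s_2 s.simps[of "numeral v" for v])
qed

text \<open>Entries after position n are not inspected. For nonzero c the order is exactly n, which
  bounds the form from below as well as from above.\<close>

fun low_term :: "nat \<Rightarrow> int \<Rightarrow> int list \<Rightarrow> bool" where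
  "low_term n c [] = False"
| "low_term 0 c (x # xs) = (x = c)"
| "low_term (Suc n) c (x # xs) = (x = 0 \<and> low_term n c xs)"

lemma low_term_ev:
  "low_term n c p \<Longrightarrow> \<exists>q. \<forall>w. ev p w = w ^ n * (of_int c + w * ev q w)"
proof (induction n c p rule: low_term.induct)
  case (2 c x xs)
  then show ?case
    by (auto intro!: exI[of _ xs])
next
  case (3 n c x xs)
  then obtain q where "\<forall>w. ev xs w = w ^ n * (of_int c + w * ev q w)"
    by auto
  with 3 show ?case
    by (auto intro!: exI[of _ q])
qed auto

lemma isCont_ev: "isCont (ev p) w"
  by (induction p) (auto intro!: continuous_intros)

lemma tendsto_ev: "(ev p \<longlongrightarrow> ev p w) (at w)"
  using isCont_ev by (simp add: isCont_def)

lemma ev_take_s_list: "n \<le> 128 \<Longrightarrow> ev (take n s_list) w = (\<Sum>i<n. real (s i) * w ^ i)"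
  by (simp add: s_list_def take_map horner_sum_eq_sum atLeast0LessThan)

text \<open>The form differs from its truncation by tails of order w^128, which still vanish at 0
  after division by w^n.\<close>

lemma low_term_limit:
  assumes low: "low_term n c (form_list p0 p1 p2)" and n: "n < 128"
  shows "((\<lambda>w. (ev p0 w + ev p1 w * S w + ev p2 w * S (w ^ 4)) / w ^ n) \<longlongrightarrow> of_int c) (at 0)"
proof -
  obtain q where q: "\<And>w. ev (form_list p0 p1 p2) w = w ^ n * (of_int c + w * ev q w)"
    using low_term_ev[OF low] by blast
  define D1 where "D1 w = S w - ev s_list w" for w
  define D2 where "D2 w = S (w ^ 4) - ev (take 32 s_list) (w ^ 4)" for w
  have ev: "eventually (\<lambda>w :: real. \<bar>w\<bar> \<le> 1/2 \<and> w \<noteq> 0) (at 0)"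
    unfolding eventually_at by (intro exI[of _ "1/2"]) (auto simp: dist_real_def)
  have small: "((\<lambda>w. D w / w ^ n) \<longlongrightarrow> 0) (at 0)"
    if D: "\<And>w. \<bar>w\<bar> \<le> 1/2 \<Longrightarrow> \<bar>D w\<bar> \<le> 2 * \<bar>w\<bar> ^ 128" for D :: "real \<Rightarrow> real"
  proof (rule Lim_null_comparison)
    show "\<forall>\<^sub>F w in at 0. norm (D w / w ^ n) \<le> 2 * \<bar>w\<bar>"
      using ev
    proof eventually_elim
      case (elim w)
      have "\<bar>D w\<bar> \<le> 2 * \<bar>w\<bar> ^ 128"
        using elim by (intro D) auto
      also have "\<bar>w\<bar> ^ 128 \<le> \<bar>w\<bar> ^ Suc n"
        using n elim by (intro power_decreasing) auto
      finally show ?case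
        using elim by (simp add: power_abs divide_le_eq mult_ac)
    qed
    show "((\<lambda>w. 2 * \<bar>w\<bar>) \<longlongrightarrow> 0) (at (0 :: real))"
      by (auto intro!: tendsto_eq_intros)
  qed
  have D1: "\<bar>D1 w\<bar> \<le> 2 * \<bar>w\<bar> ^ 128" if "\<bar>w\<bar> \<le> 1/2" for w
    using S_tail[OF that, of 128] ev_take_s_list[of 128 w] by (simp add: D1_def s_list_def)
  \<comment> \<open>The 32 coefficients of S taken at w^4 reach the order 4 * 32 = 128.\<close>
  have D2: "\<bar>D2 w\<bar> \<le> 2 * \<bar>w\<bar> ^ 128" if w: "\<bar>w\<bar> \<le> 1/2" for w
  proof -
    have "\<bar>w\<bar> ^ 4 \<le> \<bar>w\<bar> ^ 1"
      using w by (intro power_decreasing) auto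
    then have "\<bar>w ^ 4\<bar> \<le> 1/2"
      using w unfolding power_abs power_one_right by linarith
    then have "\<bar>D2 w\<bar> \<le> 2 * \<bar>w ^ 4\<bar> ^ 32"
      using S_tail[of "w ^ 4" 32] by (simp add: D2_def ev_take_s_list)
    then show ?thesis
      by (simp only: power_abs power_mult[symmetric]) simp
  qed
  have eq: "ev p0 w + ev p1 w * S w + ev p2 w * S (w ^ 4)
      = w ^ n * (of_int c + w * ev q w) + ev p1 w * D1 w + ev p2 w * D2 w" for w
    unfolding q[symmetric] form_list_def ev_padd ev_pmul ev_spread4 D1_def D2_def
    by (simp add: algebra_simps)
  have "((\<lambda>w. (of_int c + w * ev q w) + ev p1 w * (D1 w / w ^ n) + ev p2 w * (D2 w / w ^ n))
      \<longlongrightarrow> (of_int c + 0 * ev q 0) + ev p1 0 * 0 + ev p2 0 * 0) (at 0)"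
    by (intro tendsto_intros small D1 D2 tendsto_ev)
  then have "((\<lambda>w. (of_int c + w * ev q w) + ev p1 w * (D1 w / w ^ n) + ev p2 w * (D2 w / w ^ n))
      \<longlongrightarrow> of_int c) (at 0)"
    by simp
  then show ?thesis
  proof (rule Lim_transform_eventually)
    show "\<forall>\<^sub>F w in at 0. of_int c + w * ev q w + ev p1 w * (D1 w / w ^ n) + ev p2 w * (D2 w / w ^ n)
        = (ev p0 w + ev p1 w * S w + ev p2 w * S (w ^ 4)) / w ^ n"
      using ev by eventually_elim (simp add: eq add_divide_distrib)
  qed
qed

section \<open>Polynomial values at rational points: denominators and size\<close>

lemma ev_Ints:
  fixes a b :: int
  assumes b: "b \<noteq> 0" and "length p \<le> Suc d"
  shows "of_int b ^ (d * n) * ev p ((of_int a / of_int b) ^ n) \<in> \<int>"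
  using assms(2)
proof (induction p arbitrary: d)
  case (Cons x p)
  let ?B = "of_int b :: real" and ?w = "(of_int a / of_int b) ^ n :: real"
  have "?B ^ (d * n) * (?w * ev p ?w) \<in> \<int>"
  proof (cases "p = []")
    case False
    with Cons.prems obtain d' where d: "d = Suc d'" "length p \<le> Suc d'"
      by (cases d) auto
    from Ints_power_mult_mult[OF Ints_power_mult_power[OF b] Cons.IH[OF d(2)]] show ?thesis
      by (simp add: d)
  qed auto
  then show ?case
    by (simp add: distrib_left)
qed auto

lemma abs_ev_le:
  assumes "\<bar>w\<bar> \<le> 1"
  shows "\<bar>ev p w\<bar> \<le> (\<Sum>x\<leftarrow>p. \<bar>of_int x\<bar>)"
proof (induction p)
  case (Cons x p)
  have "\<bar>w * ev p w\<bar> \<le> \<bar>ev p w\<bar>"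
    using assms by (simp add: abs_mult mult_left_le_one_le)
  with Cons show ?case
    by simp
qed auto

text \<open>
  The coefficients come from solving the linear system for the vanishing of the coefficients
  between the degree of the first polynomial and the order.
\<close>

lemma low_term_127: "low_term 127 1 (form_list [-1, 1, 0, -1, 0, 0, 0, 1, 0, 0, 0, 0, 0, 0, 0, -1,
    0, 0, 0, 0, 0, 0, 0, 0, 0, 0, 0, 0, 0, 0, 0, 1] [0, -1, 1, 0, -1, -1, 1, 0, 0, -1, 1, 0, 0, 0,
    0, 0, 0, 0, 0, 0, -2, -1, 1, 0, -3, -1, 1, 0, 0, 0, 0, 0, 1, -1, 1, 0, -2, -1, 1, 0, -1, -1, 1]
    [1, 0, 0, 0, 1, 2, 0, -2, 1, 0, 0, 0, 0, 0, 0, 0, 0, 0, 0, 0, 2, 3, 0, 1, 4, 3, 0, 0, 0, 0, 0,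
    -1, 0, -1, 0, 0, 2, 3, 0, -1, 2, 1])"
  unfolding form_list_def s_list_eq by code_simp

lemma low_term_43: "low_term 43 (-1) (form_list [0,0,0,0,0,0,0,0,0,0,0,1] [-1,0,0,0,-1] [1,1,0,1,1,1])"
  unfolding form_list_def s_list_eq by code_simp

text \<open>By the functional equation this form equals S(w^16) - 1 - w^2 (S(w^4) - 1), with lowest
  term -w^6.\<close>

lemma low_term_6: "low_term 6 (-1) (form_list [-1,0,1] [0,-1] [1,1])"
  unfolding form_list_def s_list_eq by code_simp

text \<open>This form is S(w^4) - 1.\<close>

lemma low_term_4: "low_term 4 1 (form_list [-1] [] [1])"
  unfolding form_list_def s_list_eq by code_simp

subsection \<open>From forms to lower bounds\<close>

text \<open>Replacing the two numbers by p1/q and p2/q changes the form from L to L - D, and N = m q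
  (L - D) is an integer. If N = 0, then |D| = |L| >= t. Otherwise |L - D| >= 8 t, and |L| <= 4 t
  leaves |D| >= 4 t. In both cases |D| is at most 2 C times the distance.\<close>

lemma integer_form_bound:
  fixes \<alpha> \<beta> B0 B1 B2 :: real and p1 p2 q :: int
  assumes Ints: "m * B0 \<in> \<int>" "m * B1 \<in> \<int>" "m * B2 \<in> \<int>"
    and le: "\<bar>B1\<bar> \<le> C" "\<bar>B2\<bar> \<le> C" and C: "C > 0" and m: "m > 0"
    and L: "t \<le> \<bar>B0 + B1 * \<alpha> + B2 * \<beta>\<bar>" "\<bar>B0 + B1 * \<alpha> + B2 * \<beta>\<bar> \<le> 4 * t"
    and q: "q \<ge> 1" "8 * t * of_int q * m \<le> 1"
  shows "t / (2 * C) \<le> max \<bar>\<alpha> - of_int p1 / of_int q\<bar> \<bar>\<beta> - of_int p2 / of_int q\<bar>" (is "_ \<le> ?\<delta>")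
proof -
  define D where "D = B1 * (\<alpha> - of_int p1 / of_int q) + B2 * (\<beta> - of_int p2 / of_int q)"
  define L where "L = B0 + B1 * \<alpha> + B2 * \<beta>"
  have "\<bar>D\<bar> \<le> \<bar>B1\<bar> * \<bar>\<alpha> - of_int p1 / of_int q\<bar> + \<bar>B2\<bar> * \<bar>\<beta> - of_int p2 / of_int q\<bar>"
    unfolding D_def by (rule order_trans[OF abs_triangle_ineq]) (simp add: abs_mult)
  also have "\<dots> \<le> C * ?\<delta> + C * ?\<delta>"
    using le C by (intro add_mono mult_mono) auto
  finally have D: "\<bar>D\<bar> \<le> 2 * C * ?\<delta>"
    by simp
  have q0: "of_int q > (0 :: real)"
    using q by simp
  define N where "N = m * B0 * of_int q + m * B1 * of_int p1 + m * B2 * of_int p2"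
  have N: "N = m * of_int q * (L - D)"
    using q0 by (simp add: N_def L_def D_def field_simps)
  have "N \<in> \<int>"
    unfolding N_def by (intro Ints_add Ints_mult[OF Ints(1) Ints_of_int]
        Ints_mult[OF Ints(2) Ints_of_int] Ints_mult[OF Ints(3) Ints_of_int])
  have "t \<le> \<bar>D\<bar>"
  proof (cases "N = 0")
    case True
    then have "L = D"
      using N m q0 by simp
    with L show ?thesis
      by (simp add: L_def)
  next
    case False
    with \<open>N \<in> \<int>\<close> have "1 \<le> \<bar>N\<bar>"
      by (rule Ints_nonzero_abs_ge1)
    also have "\<bar>N\<bar> = m * of_int q * \<bar>L - D\<bar>"
      using m q0 by (simp add: N abs_mult)
    finally have "8 * t * of_int q * m \<le> m * of_int q * \<bar>L - D\<bar>"
      using q by linarith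
    then have "(m * of_int q) * (8 * t) \<le> (m * of_int q) * \<bar>L - D\<bar>"
      by (simp add: mult_ac)
    then have "8 * t \<le> \<bar>L - D\<bar>"
      by (rule mult_left_le_imp_le) (use m q0 in simp)
    with L show ?thesis
      unfolding L_def[symmetric] by linarith
  qed
  with D have "t \<le> 2 * C * ?\<delta>"
    by linarith
  with C show ?thesis
    by (simp add: field_simps)
qed

text \<open>One constant K weakens both the range of q and the distance, so several forms can share
  the largest of their constants.\<close>

definition repelled :: "real \<Rightarrow> real \<Rightarrow> real \<Rightarrow> real \<Rightarrow> real \<Rightarrow> bool" where
  "repelled \<alpha> \<beta> K r d \<longleftrightarrow> (\<forall>p1 p2 q :: int. q \<ge> 1 \<longrightarrow> of_int q * K \<le> r \<longrightarrow>
     d / K \<le> max \<bar>\<alpha> - of_int p1 / of_int q\<bar> \<bar>\<beta> - of_int p2 / of_int q\<bar>)"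

lemma repelledD:
  "repelled \<alpha> \<beta> K r d \<Longrightarrow> q \<ge> 1 \<Longrightarrow> of_int q * K \<le> r \<Longrightarrow>
     d / K \<le> max \<bar>\<alpha> - of_int p1 / of_int q\<bar> \<bar>\<beta> - of_int p2 / of_int q\<bar>"
  unfolding repelled_def by blast

lemma repelled_mono:
  assumes "repelled \<alpha> \<beta> K r d" "0 < K" "K \<le> K'" "0 \<le> d"
  shows "repelled \<alpha> \<beta> K' r d"
  unfolding repelled_def
proof (intro allI impI)
  fix p1 p2 q :: int
  assume q: "q \<ge> 1" "of_int q * K' \<le> r"
  have "of_int q * K \<le> of_int q * K'"
    using q assms by (intro mult_left_mono) auto
  then have "d / K \<le> max \<bar>\<alpha> - of_int p1 / of_int q\<bar> \<bar>\<beta> - of_int p2 / of_int q\<bar>"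
    using q by (intro repelledD[OF assms(1)]) linarith+
  moreover have "d / K' \<le> d / K"
    using assms by (intro divide_left_mono) auto
  ultimately show "d / K' \<le> max \<bar>\<alpha> - of_int p1 / of_int q\<bar> \<bar>\<beta> - of_int p2 / of_int q\<bar>"
    by linarith
qed

text \<open>The summands 1/6 and 2/3 are the costs of expanding S at z^(4^k) and at z^(4^(k+1)), the
  factors of p1 and p2.\<close>

lemma form_repels:
  fixes a b :: int and x h :: real and p0 p1 p2 :: "int list"
  defines "z \<equiv> of_int a / of_int b"
  assumes b: "b \<ge> 2" and z: "\<bar>z\<bar> = of_int b powr - x" and x: "x > 0"
    and low: "low_term n c (form_list p0 p1 p2)" "n < 128" "c \<noteq> 0"
    and len: "length p0 \<le> Suc d0" "length p1 \<le> Suc d1" "length p2 \<le> Suc d2"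
    and h: "real d0 \<le> h" "real d1 + 1/6 \<le> h" "real d2 + 2/3 \<le> h"
  shows "\<exists>K>0. \<forall>\<^sub>F k in sequentially. repelled (S z) (S (z ^ 4)) K
    (of_int b powr ((x * n - h) * 4 ^ k)) (of_int b powr - (x * n * 4 ^ k))"
proof -
  let ?B = "of_int b :: real"
  have z1: "\<bar>z\<bar> < 1"
    using z x b by (simp add: powr_less_one)
  have z0: "z \<noteq> 0"
    using z b by auto
  define w where "w k = z ^ 4 ^ k" for k :: nat
  have w1: "\<bar>w k\<bar> \<le> 1" for k
    using z1 by (simp add: w_def power_abs power_le_one)
  have w: "\<bar>w k\<bar> = ?B powr - (x * 4 ^ k)" for k
    using b by (simp add: w_def power_abs z powr_power mult.commute)
  define X where "X = iter_coeff z 1 0"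
  define Y where "Y = iter_coeff z 0 1"
  define B1 where "B1 k = ev p1 (w k) * X k + ev p2 (w k) * X (Suc k)" for k
  define B2 where "B2 k = ev p1 (w k) * Y k + ev p2 (w k) * Y (Suc k)" for k
  define C where "C = 1 + ((\<Sum>y\<leftarrow>p1. \<bar>of_int y\<bar>) + (\<Sum>y\<leftarrow>p2. \<bar>of_int y\<bar>)) * exp (3 / (1 - \<bar>z\<bar>))"
  have bound: "\<bar>ev p1 (w k) * V k + ev p2 (w k) * V (Suc k)\<bar> \<le> C"
    if "\<And>k. \<bar>V k\<bar> \<le> exp (3 / (1 - \<bar>z\<bar>))" for V k
  proof -
    have "\<bar>ev p1 (w k) * V k + ev p2 (w k) * V (Suc k)\<bar>
        \<le> \<bar>ev p1 (w k)\<bar> * \<bar>V k\<bar> + \<bar>ev p2 (w k)\<bar> * \<bar>V (Suc k)\<bar>"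
      by (rule order_trans[OF abs_triangle_ineq]) (simp add: abs_mult)
    also have "\<dots> \<le> (\<Sum>y\<leftarrow>p1. \<bar>of_int y\<bar>) * exp (3 / (1 - \<bar>z\<bar>)) + (\<Sum>y\<leftarrow>p2. \<bar>of_int y\<bar>) * exp (3 / (1 - \<bar>z\<bar>))"
      by (intro add_mono mult_mono abs_ev_le w1 that sum_list_nonneg) auto
    finally show ?thesis
      by (simp add: C_def algebra_simps)
  qed
  have C: "\<bar>B1 k\<bar> \<le> C" "\<bar>B2 k\<bar> \<le> C" for k
    unfolding B1_def B2_def X_def Y_def by (intro bound iter_coeff_bounded z1; simp)+
  have C0: "C > 0"
    unfolding C_def by (intro add_pos_nonneg mult_nonneg_nonneg add_nonneg_nonneg sum_list_nonneg) auto
  define M where "M k = max (d0 * 4 ^ k) (max (d1 * 4 ^ k + iter_deg k) (d2 * 4 ^ k + iter_deg (Suc k)))"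
    for k
  have M: "real (M k) \<le> h * 4 ^ k" for k
  proof -
    have "6 * real (iter_deg k) \<le> 4 ^ k" "6 * real (iter_deg (Suc k)) \<le> 4 * 4 ^ k"
      using iter_deg_le[of k] iter_deg_le[of "Suc k"]
      by (simp_all flip: of_nat_le_iff[where 'a = real])
    moreover have "real d0 * 4 ^ k \<le> h * 4 ^ k" "(real d1 + 1/6) * 4 ^ k \<le> h * 4 ^ k"
      "(real d2 + 2/3) * 4 ^ k \<le> h * 4 ^ k"
      using h by (auto intro: mult_right_mono)
    ultimately show ?thesis
      unfolding M_def by (auto simp: max_def algebra_simps)
  qed
  have Int0: "?B ^ M k * ev p0 (w k) \<in> \<int>" for k
    unfolding w_def z_def by (rule Ints_power_mult_mono[OF ev_Ints[OF _ len(1)]]) (use b in \<open>auto simp: M_def\<close>)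
  have Int: "?B ^ M k * (ev p1 (w k) * V k + ev p2 (w k) * V (Suc k)) \<in> \<int>"
    if "\<And>k. ?B ^ iter_deg k * V k \<in> \<int>" for V k
    unfolding distrib_left w_def z_def
    by (intro Ints_add Ints_power_mult_mono[OF Ints_power_mult_mult[OF ev_Ints[OF _ len(2)] that]]
        Ints_power_mult_mono[OF Ints_power_mult_mult[OF ev_Ints[OF _ len(3)] that]])
      (use b in \<open>auto simp: M_def\<close>)
  have Int12: "?B ^ M k * B1 k \<in> \<int>" "?B ^ M k * B2 k \<in> \<int>" for k
    unfolding B1_def B2_def X_def Y_def using b
    by (intro Int, unfold z_def, intro iter_coeff_Ints; simp)+
  have form: "ev p0 (w k) + B1 k * S z + B2 k * S (z ^ 4)
      = ev p0 (w k) + ev p1 (w k) * S (w k) + ev p2 (w k) * S (w k ^ 4)" for k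
  proof -
    have "w k ^ 4 = w (Suc k)"
      by (simp add: w_def mult.commute flip: power_mult)
    moreover have "S (w i) = X i * S z + Y i * S (z ^ 4)" for i
      unfolding w_def X_def Y_def by (rule S_iterate[OF z1])
    ultimately show ?thesis
      by (simp add: B1_def B2_def algebra_simps)
  qed
  \<comment> \<open>The quotient of the form by w^n tends in absolute value to 2 g, hence is
    eventually between g and 4 g: the factor 4 of \<open>integer_form_bound\<close>.\<close>
  define g where "g = \<bar>real_of_int c\<bar> / 2"
  have g: "g > 0"
    using low(3) by (simp add: g_def)
  \<comment> \<open>\<open>8 * g\<close> absorbs the size condition on q, \<open>2 * C / g\<close>
    the constant in the distance.\<close>
  define K where "K = max (8 * g) (2 * C / g)"
  have K: "K > 0" "8 * g \<le> K" "2 * C / g \<le> K"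
    using g by (auto simp: K_def less_max_iff_disj)
  have "w \<longlonglongrightarrow> 0"
    unfolding w_def
    by (rule LIMSEQ_subseq_LIMSEQ[OF LIMSEQ_power_zero, unfolded o_def]) (use z1 in \<open>auto simp: strict_mono_def\<close>)
  then have "filterlim w (at 0) sequentially"
    using z0 by (auto simp: filterlim_at w_def)
  then have "((\<lambda>k. \<bar>(ev p0 (w k) + B1 k * S z + B2 k * S (z ^ 4)) / w k ^ n\<bar>) \<longlongrightarrow> \<bar>of_int c\<bar>) sequentially"
    unfolding form by (intro tendsto_rabs filterlim_compose[OF low_term_limit[OF low(1,2)]])
  then have "\<forall>\<^sub>F k in sequentially. \<bar>(ev p0 (w k) + B1 k * S z + B2 k * S (z ^ 4)) / w k ^ n\<bar> \<in> {g<..<4 * g}"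
    by (rule topological_tendstoD) (use g in \<open>auto simp: g_def\<close>)
  then show ?thesis
  proof (intro exI[of _ K] conjI K(1), eventually_elim)
    case (elim k)
    define t where "t = ?B powr - (x * n * 4 ^ k)"
    have t: "\<bar>w k ^ n\<bar> = t" "t > 0"
      using b by (auto simp: t_def power_abs w powr_power mult_ac)
    let ?L = "ev p0 (w k) + B1 k * S z + B2 k * S (z ^ 4)"
    have L: "g * t \<le> \<bar>?L\<bar>" "\<bar>?L\<bar> \<le> 4 * (g * t)"
      using elim t by (auto simp: field_simps)
    have "t / K \<le> max \<bar>S z - of_int p1 / of_int q\<bar> \<bar>S (z ^ 4) - of_int p2 / of_int q\<bar>"
      if q: "q \<ge> 1" "of_int q * K \<le> ?B powr ((x * n - h) * 4 ^ k)" for p1 p2 q :: int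
    proof -
      have "of_int q * (8 * g) \<le> of_int q * K"
        using q K by (intro mult_left_mono) auto
      also note q(2)
      finally have "(of_int q * (8 * g)) * (t * ?B ^ M k) \<le> ?B powr ((x * n - h) * 4 ^ k) * (t * ?B ^ M k)"
        using t b by (intro mult_right_mono) auto
      also have "?B ^ M k \<le> ?B powr (h * 4 ^ k)"
        using M[of k] b by (simp flip: powr_realpow)
      then have "?B powr ((x * n - h) * 4 ^ k) * (t * ?B ^ M k) \<le> ?B powr ((x * n - h) * 4 ^ k) * (t * ?B powr (h * 4 ^ k))"
        using t by (intro mult_left_mono) auto
      also have "\<dots> = 1"
        using b by (simp add: t_def algebra_simps flip: powr_add)
      finally have "8 * (g * t) * of_int q * ?B ^ M k \<le> 1"
        by (simp add: mult_ac)
      with Int0 Int12 C C0 L q b have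
        "g * t / (2 * C) \<le> max \<bar>S z - of_int p1 / of_int q\<bar> \<bar>S (z ^ 4) - of_int p2 / of_int q\<bar>"
        by (intro integer_form_bound[of "?B ^ M k" "ev p0 (w k)" "B1 k" "B2 k"]) auto
      moreover have "t / K \<le> t / (2 * C / g)"
        using t K C0 g by (intro divide_left_mono) auto
      ultimately show ?thesis
        by (simp add: mult.commute)
    qed
    then show ?case
      unfolding repelled_def t_def by blast
  qed
qed

subsection \<open>Bounding the exponent\<close>

text \<open>For m > \<tau>, a solution with q > q0 satisfies \<kappa> q^(m - \<tau>) < 1. This
  bounds q, and then the numerators, so only finitely many solutions exist.\<close>

lemma mu2_le:
  fixes \<alpha> \<beta> \<kappa> \<tau> q0 :: real
  assumes \<kappa>: "\<kappa> > 0" and \<tau>: "\<tau> \<ge> 0"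
    and bound: "\<And>p1 p2 q :: int. q \<ge> 1 \<Longrightarrow> of_int q > q0 \<Longrightarrow>
      \<kappa> * of_int q powr - \<tau> \<le> max \<bar>\<alpha> - of_int p1 / of_int q\<bar> \<bar>\<beta> - of_int p2 / of_int q\<bar>"
  shows "mu2 \<alpha> \<beta> \<le> ereal \<tau>"
  unfolding mu2_def
proof (rule Sup_least, clarsimp, rule ccontr)
  fix m :: real
  let ?A = "{(p1::int, p2::int, q::int). q \<ge> 1 \<and>
    max \<bar>\<alpha> - of_int p1 / of_int q\<bar> \<bar>\<beta> - of_int p2 / of_int q\<bar> < real_of_int q powr (- m)}"
  assume inf: "infinite {(p1::int, p2::int, q::int). 1 \<le> q \<and>
    \<bar>\<alpha> - of_int p1 / of_int q\<bar> < of_int q powr - m \<and> \<bar>\<beta> - of_int p2 / of_int q\<bar> < of_int q powr - m}"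
  assume "\<not> m \<le> \<tau>"
  then have m: "m > \<tau>"
    by simp
  define Q where "Q = max q0 ((1 / \<kappa>) powr (1 / (m - \<tau>)))"
  have Q: "of_int q \<le> Q" if "q \<ge> 1" "max \<bar>\<alpha> - of_int p1 / of_int q\<bar> \<bar>\<beta> - of_int p2 / of_int q\<bar> < of_int q powr - m"
    for p1 p2 q :: int
  proof (rule ccontr)
    assume "\<not> of_int q \<le> Q"
    then have q: "of_int q > q0" "(1 / \<kappa>) powr (1 / (m - \<tau>)) < of_int q"
      by (auto simp: Q_def)
    have "1 / \<kappa> = ((1 / \<kappa>) powr (1 / (m - \<tau>))) powr (m - \<tau>)"
      using m \<kappa> by (simp add: powr_powr)
    also have "\<dots> < of_int q powr (m - \<tau>)"
      using q m \<kappa> by (intro powr_less_mono2) auto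
    finally have "1 < \<kappa> * of_int q powr (m - \<tau>)"
      using \<kappa> by (simp add: field_simps)
    then have "1 * of_int q powr - m < \<kappa> * of_int q powr (m - \<tau>) * of_int q powr - m"
      using that by (intro mult_strict_right_mono) auto
    also have "\<dots> = \<kappa> * of_int q powr - \<tau>"
      by (simp add: mult.assoc flip: powr_add)
    also have "\<dots> \<le> max \<bar>\<alpha> - of_int p1 / of_int q\<bar> \<bar>\<beta> - of_int p2 / of_int q\<bar>"
      using that q by (intro bound)
    finally show False
      using that by simp
  qed
  have p: "p \<in> {- \<lceil>Q * (\<bar>\<gamma>\<bar> + 1)\<rceil>..\<lceil>Q * (\<bar>\<gamma>\<bar> + 1)\<rceil>}"
    if "q \<ge> 1" "of_int q \<le> Q" "\<bar>\<gamma> - of_int p / of_int q\<bar> < of_int q powr - m" for p q :: int and \<gamma> :: real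
  proof -
    \<comment> \<open>As m > \<tau> >= 0, the fraction p/q lies within 1 of \<gamma>.\<close>
    have "real_of_int q powr - m \<le> real_of_int q powr 0"
      using that m \<tau> by (intro powr_mono) auto
    then have "\<bar>\<gamma> - of_int p / of_int q\<bar> < 1"
      using that by simp
    then have "\<bar>of_int p / of_int q\<bar> \<le> \<bar>\<gamma>\<bar> + 1"
      by linarith
    then have "\<bar>of_int p :: real\<bar> \<le> of_int q * (\<bar>\<gamma>\<bar> + 1)"
      using that by (simp add: abs_divide divide_le_eq mult.commute)
    also have "\<dots> \<le> Q * (\<bar>\<gamma>\<bar> + 1)"
      using that by (intro mult_right_mono) auto
    finally have "\<bar>of_int p :: real\<bar> \<le> Q * (\<bar>\<gamma>\<bar> + 1)" .
    then have "\<bar>p\<bar> \<le> \<lceil>Q * (\<bar>\<gamma>\<bar> + 1)\<rceil>"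
      by linarith
    then show ?thesis
      by auto
  qed
  have "?A \<subseteq> {- \<lceil>Q * (\<bar>\<alpha>\<bar> + 1)\<rceil>..\<lceil>Q * (\<bar>\<alpha>\<bar> + 1)\<rceil>} \<times>
      {- \<lceil>Q * (\<bar>\<beta>\<bar> + 1)\<rceil>..\<lceil>Q * (\<bar>\<beta>\<bar> + 1)\<rceil>} \<times> {1..\<lfloor>Q\<rfloor>}"
  proof (rule subsetI, clarify)
    fix p1 p2 q :: int
    assume *: "q \<ge> 1" "max \<bar>\<alpha> - of_int p1 / of_int q\<bar> \<bar>\<beta> - of_int p2 / of_int q\<bar> < real_of_int q powr (- m)"
    note q = Q[OF *]
    then have "q \<le> \<lfloor>Q\<rfloor>"
      by (simp add: le_floor_iff)
    with p[OF *(1) q] * show "p1 \<in> {- \<lceil>Q * (\<bar>\<alpha>\<bar> + 1)\<rceil>..\<lceil>Q * (\<bar>\<alpha>\<bar> + 1)\<rceil>} \<and>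
      (p2, q) \<in> {- \<lceil>Q * (\<bar>\<beta>\<bar> + 1)\<rceil>..\<lceil>Q * (\<bar>\<beta>\<bar> + 1)\<rceil>} \<times> {1..\<lfloor>Q\<rfloor>}"
      by (auto simp del: atLeastAtMost_iff) auto
  qed
  then have "finite ?A"
    by (rule finite_subset) auto
  with inf show False
    by simp
qed

text \<open>B^r is where the preceding range ends. Since q K exceeds it, the repulsion B^(-d) is at
  least (q K)^(-\<tau>).\<close>

lemma repelled_step:
  assumes rep: "repelled \<alpha> \<beta> K (B powr r') (B powr - d)" and d: "d \<le> \<tau> * r"
    and q: "q \<ge> 1" "B powr r < of_int q * K" "of_int q * K \<le> B powr r'"
    and B: "B > 1" and K: "K > 0" and \<tau>: "\<tau> \<ge> 0"
  shows "K powr - \<tau> / K * of_int q powr - \<tau> \<le> max \<bar>\<alpha> - of_int p1 / of_int q\<bar> \<bar>\<beta> - of_int p2 / of_int q\<bar>"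
proof -
  have "(of_int q * K) powr - \<tau> \<le> (B powr r) powr - \<tau>"
    using q \<tau> B by (intro powr_mono2') auto
  also have "\<dots> \<le> B powr - d"
    using d B by (simp add: powr_powr mult.commute)
  finally have "(of_int q * K) powr - \<tau> / K \<le> B powr - d / K"
    using K by (intro divide_right_mono) auto
  also have "\<dots> \<le> max \<bar>\<alpha> - of_int p1 / of_int q\<bar> \<bar>\<beta> - of_int p2 / of_int q\<bar>"
    using rep q(1,3) by (rule repelledD)
  finally show ?thesis
    using q K by (simp add: powr_mult mult.commute)
qed

text \<open>The exponent is 172 x / (127 x - 128/3), slightly above the cost 172 x / (127 x - 253/6)
  of passing from order 127 to order 172.\<close>

lemma mu2_S_le:
  fixes a b :: int and x :: real
  defines "z \<equiv> of_int a / of_int b"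
  assumes b: "b \<ge> 2" and z: "\<bar>z\<bar> = of_int b powr - x" and x: "113 / 291 < x" "x \<le> 1"
  shows "mu2 (S z) (S (z ^ 4)) \<le> ereal (516 * x / (381 * x - 128))"
proof -
  let ?B = "of_int b :: real"
  let ?P = "\<lambda>K o' h k. repelled (S z) (S (z ^ 4)) K
    (?B powr ((x * real o' - h) * 4 ^ k)) (?B powr - (x * real o' * 4 ^ k))"
  have x0: "x > 0"
    using x by simp
  note rep = form_repels[OF b z[unfolded z_def] x0, folded z_def]
  \<comment> \<open>The value of h is attained by \<open>d1 + 1/6\<close> for this form, by
    \<open>d0\<close> for orders 43 and 6, and by \<open>d2 + 2/3\<close> for order 4. Here the
    degree bounds 42, 42, 41 leave 128 coefficients for 127 vanishing conditions.\<close>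
  obtain K1 where K1: "K1 > 0" "\<forall>\<^sub>F k in sequentially. ?P K1 127 (253/6) k"
    using rep[OF low_term_127, of 42 42 41 "253/6"] by auto
  obtain K2 where K2: "K2 > 0" "\<forall>\<^sub>F k in sequentially. ?P K2 43 11 k"
    using rep[OF low_term_43, of 11 10 10 11] by auto
  obtain K3 where K3: "K3 > 0" "\<forall>\<^sub>F k in sequentially. ?P K3 4 (2/3) k"
    using rep[OF low_term_4, of 0 0 0 "2/3"] by auto
  obtain K4 where K4: "K4 > 0" "\<forall>\<^sub>F k in sequentially. ?P K4 6 2 k"
    using rep[OF low_term_6, of 2 1 1 2] by auto
  define K where "K = max (max K1 K2) (max K3 K4)"
  have K: "K > 0" "K1 \<le> K" "K2 \<le> K" "K3 \<le> K" "K4 \<le> K"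
    using K1(1) by (auto simp: K_def)
  have mono: "\<forall>\<^sub>F k in sequentially. ?P K n h (k + j)"
    if "\<forall>\<^sub>F k in sequentially. ?P K' n h k" "K' > 0" "K' \<le> K" for K' n h j
    using sequentially_offset[OF that(1), of j]
    by eventually_elim (use that in \<open>auto intro: repelled_mono\<close>)
  have "\<forall>\<^sub>F k in sequentially. ?P K 127 (253/6) (k + 0) \<and> ?P K 43 11 (k + 1) \<and> ?P K 4 (2/3) (k + 3)
      \<and> ?P K 6 2 (k + 3) \<and> ?P K 127 (253/6) (k + 1)"
    by (intro eventually_conj mono[OF K1(2)] mono[OF K2(2)] mono[OF K3(2)] mono[OF K4(2)] K K1 K2 K3 K4)
  then obtain k0 where k0: "\<And>k. k \<ge> k0 \<Longrightarrow> ?P K 127 (253/6) (k + 0) \<and> ?P K 43 11 (k + 1)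
      \<and> ?P K 4 (2/3) (k + 3) \<and> ?P K 6 2 (k + 3) \<and> ?P K 127 (253/6) (k + 1)"
    unfolding eventually_sequentially by blast
  define \<tau> where "\<tau> = 516 * x / (381 * x - 128)"
  have D: "381 * x - 128 > 0"
    using x by simp
  have \<tau>: "\<tau> \<ge> 0"
    using D x0 by (simp add: \<tau>_def)
  have step: "x * n * 4 ^ i \<le> \<tau> * (r * 4 ^ j)"
    if "n * (381 * x - 128) * 4 ^ i \<le> 516 * r * 4 ^ j" for n r :: real and i j :: nat
  proof -
    have "x * (n * (381 * x - 128) * 4 ^ i) \<le> x * (516 * r * 4 ^ j)"
      using that x0 by (intro mult_left_mono) auto
    then show ?thesis
      using D by (simp add: \<tau>_def field_simps)
  qed
  define R where "R k = (x * real 127 - 253/6) * 4 ^ k" for k :: nat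
  have R: "R i \<le> R j" if "i \<le> j" for i j
    unfolding R_def using x that by (intro mult_left_mono power_increasing) auto
  have bound: "K powr - \<tau> / K * of_int q powr - \<tau>
      \<le> max \<bar>S z - of_int p1 / of_int q\<bar> \<bar>S (z ^ 4) - of_int p2 / of_int q\<bar>"
    if q: "q \<ge> 1" "?B powr R k0 / K < of_int q" for p1 p2 q :: int
  proof -
    define y where "y = of_int q * K"
    have y: "?B powr R k0 < y"
      using q K by (simp add: y_def field_simps)
    obtain n where n: "log ?B y / (x * 127 - 253/6) < 4 ^ n"
      using real_arch_pow[of 4] by auto
    then have "log ?B y \<le> R n"
      using x by (simp add: R_def field_simps)
    moreover have "y > 0"
      using q K by (simp add: y_def)
    ultimately have n: "y \<le> ?B powr R n"
      using b by (simp add: log_le_iff)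
    \<comment> \<open>Minimality of l puts y between two successive ends \<open>R\<close> of the
      ranges of order 127; the ranges of the other three forms subdivide this gap.\<close>
    define l where "l = (LEAST n. y \<le> ?B powr R n)"
    have l: "y \<le> ?B powr R l"
      unfolding l_def using n by (rule LeastI)
    have "l > k0"
    proof (rule ccontr)
      assume "\<not> l > k0"
      then have "?B powr R l \<le> ?B powr R k0"
        using b R[of l k0] by simp
      with l y show False
        by simp
    qed
    then obtain k where k: "l = Suc k" "k \<ge> k0"
      by (cases l) auto
    have lower: "?B powr R k < y"
      using not_less_Least[of k "\<lambda>n. y \<le> ?B powr R n"] k by (simp add: l_def)
    have B: "?B > 1"
      using b by simp
    have P: "?P K 43 11 (k + 1)" "?P K 4 (2/3) (k + 3)" "?P K 6 2 (k + 3)" "?P K 127 (253/6) (k + 1)"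
      using k0[OF k(2)] by blast+
    note step_bound = repelled_step[OF _ step q(1) _ _ B K(1) \<tau>, folded y_def]
    consider "y \<le> ?B powr ((x * real 43 - 11) * 4 ^ (k + 1))"
      | "?B powr ((x * real 43 - 11) * 4 ^ (k + 1)) < y" "y \<le> ?B powr ((x * real 4 - 2/3) * 4 ^ (k + 3))"
      | "?B powr ((x * real 4 - 2/3) * 4 ^ (k + 3)) < y" "y \<le> ?B powr ((x * real 6 - 2) * 4 ^ (k + 3))"
      | "?B powr ((x * real 6 - 2) * 4 ^ (k + 3)) < y" "y \<le> ?B powr R (k + 1)"
      using l unfolding k(1) Suc_eq_plus1 by (meson not_le)
    then show ?thesis
    \<comment> \<open>After division by 4^k the requirements are linear in x: -22016 <= -21758, 8784
      x <= 10064, 14208 x <= 27136 and 1024 <= 4596 x.\<close>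
    proof cases
      case 1
      show ?thesis
        by (rule step_bound[OF P(1) _ lower[unfolded R_def] 1]) (use x in \<open>simp add: power_add\<close>)
    next
      case 2
      show ?thesis
        by (rule step_bound[OF P(2) _ 2]) (use x in \<open>simp add: power_add\<close>)
    next
      case 3
      show ?thesis
        by (rule step_bound[OF P(3) _ 3]) (use x in \<open>simp add: power_add\<close>)
    next
      case 4
      show ?thesis
        by (rule step_bound[OF P(4) _ 4[unfolded R_def]]) (use x in \<open>simp add: power_add\<close>)
    qed
  qed
  have "K powr - \<tau> / K > 0"
    using K by simp
  then show ?thesis
    using \<tau> bound unfolding \<tau>_def[symmetric] by (rule mu2_le)
qed

theorem theorem4:
  shows "(\<forall>b::int. b \<ge> 2 \<longrightarrow>
            mu2 (S (1 / of_int b)) (S (1 / of_int b ^ 4)) \<le> ereal (516 / 253))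
       \<and> (\<forall>(a::int) (b::int) (lam::real).
            b \<ge> 2 \<and> a \<noteq> 0 \<and> ln \<bar>real_of_int a\<bar> = lam * ln (real_of_int b)
            \<and> 0 \<le> lam \<and> lam < 178 / 291 \<longrightarrow>
            mu2 (S (of_int a / of_int b)) (S ((of_int a / of_int b) ^ 4))
              \<le> ereal (516 * (1 - lam) / (253 - 381 * lam)))"
proof -
  have main: "mu2 (S (of_int a / of_int b)) (S ((of_int a / of_int b) ^ 4))
      \<le> ereal (516 * (1 - lam) / (253 - 381 * lam))"
    if b: "b \<ge> 2" and a: "a \<noteq> 0" "ln \<bar>real_of_int a\<bar> = lam * ln (real_of_int b)"
      and lam: "0 \<le> lam" "lam < 178 / 291" for a b :: int and lam :: real
  proof -
    have "\<bar>real_of_int a\<bar> = of_int b powr lam"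
      using a b by (simp add: powr_def flip: a(2))
    then have "\<bar>of_int a / of_int b :: real\<bar> = of_int b powr - (1 - lam)"
      using b by (simp add: abs_divide powr_diff)
    \<comment> \<open>For x = 1 - lam, the denominator 381 x - 128 becomes 253 - 381 lam, and lam <
      178/291 becomes x > 113/291.\<close>
    from mu2_S_le[OF b this] lam show ?thesis
      by (simp add: algebra_simps)
  qed
  moreover have "mu2 (S (1 / of_int b)) (S (1 / of_int b ^ 4)) \<le> ereal (516 / 253)" if "b \<ge> 2" for b :: int
    using main[of b 1 0] that by (simp add: power_divide)
  ultimately show ?thesis
    by blast
qed

end
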